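(* For every integer $n \geq 0$, the construction number of the star $K_{1,n}$ is $c(K_{1,n}) = 2^n (n!)^2$.
   Context: Graphs are finite, simple and undirected. The elements of a graph $G=(V,E)$ are the members of $V \cup E$ (its vertices and edges). A construction sequence (c-sequence) for $G$ is a listing of all the elements of $G$, without repetitions, such that each edge appears after both of its endpoints. The construction number $c(G)$ is the number of distinct construction sequences for $G$. $K_{1,n}$ is the star with $n+1$ vertices: one hub vertex adjacent to $n$ other vertices, with no further edges. *)

theory Defs
  imports Main
begin

type_synonym 'a graph = "'a set \<times> 'a set set"

abbreviation verts :: "'a graph \<Rightarrow> 'a set" where
  "verts \<equiv> fst"

abbreviation edges :: "'a graph \<Rightarrow> 'a set set" where
  "edges \<equiv> snd"

definition simple_graph :: "'a graph \<Rightarrow> bool" where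
  "simple_graph G \<longleftrightarrow> finite (verts G) \<and> (\<forall>e\<in>edges G. e \<subseteq> verts G \<and> card e = 2)"

datatype 'a element = Vertex 'a | Edge "'a set"

definition elements :: "'a graph \<Rightarrow> 'a element set" where
  "elements G = Vertex ` verts G \<union> Edge ` edges G"

definition c_sequence :: "'a graph \<Rightarrow> 'a element list \<Rightarrow> bool" where
  "c_sequence G xs \<longleftrightarrow> distinct xs \<and> set xs = elements G \<and>
     (\<forall>i<length xs. \<forall>j<length xs. \<forall>v e.
        xs ! i = Vertex v \<and> xs ! j = Edge e \<and> v \<in> e \<longrightarrow> i < j)"

definition construction_number :: "'a graph \<Rightarrow> nat" where
  "construction_number G = card {xs. c_sequence G xs}"

(* The graphs isomorphic to K_{1,n}; h is the hub. For n = 1 either endpoint can be h. *)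
definition is_star :: "nat \<Rightarrow> 'a graph \<Rightarrow> bool" where
  "is_star n G \<longleftrightarrow> simple_graph G \<and>
     (\<exists>h\<in>verts G. card (verts G - {h}) = n \<and> edges G = {{h, v} | v. v \<in> verts G - {h}})"

(* Every n is realised. *)
lemma is_star_nat: "is_star n ({0..n}, {{0, i} | i. i \<in> {1..n}})"
proof -
  have V: "{0..n} - {0} = {1..n}" by auto
  have "simple_graph ({0..n}, {{0, i} | i. i \<in> {1..n}})"
    by (auto simp: simple_graph_def)
  moreover have "card ({0..n} - {0}) = n"
    unfolding V by simp
  ultimately show ?thesis
    unfolding is_star_def fst_conv snd_conv using V by (intro conjI bexI[of _ 0]) simp_all
qed

end

theory Submission
  imports Defs
begin

text \<open>
  The formula comes from the recurrence \<open>c(K\<^sub>1\<^sub>,\<^sub>n) = n \<cdot> 2n \<cdot> c(K\<^sub>1\<^sub>,\<^sub>n\<^sub>-\<^sub>1)\<close> for \<open>n \<ge> 1\<close>, which follows from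
  two facts about arbitrary finite graphs.

  In a nonempty graph without isolated vertices every vertex must be followed by an edge, so a construction
  sequence ends in an edge \<open>e\<close>; deleting it leaves an arbitrary construction sequence of \<open>G - e\<close>.
  Hence \<open>c(G)\<close> is the sum of \<open>c(G - e)\<close> over all edges \<open>e\<close>
  (\<open>construction_number_remove_edge\<close>). On the other hand, an isolated vertex is under no
  constraint and may be inserted at any place of a construction sequence of the rest of the graph,
  so adding it multiplies the construction number by the number of elements plus one
  (\<open>construction_number_insert_isolated\<close>).

  Removing one of the \<open>n\<close> edges of \<open>K\<^sub>1\<^sub>,\<^sub>n\<close> turns its leaf into an isolated vertex next to a copy of
  \<open>K\<^sub>1\<^sub>,\<^sub>n\<^sub>-\<^sub>1\<close>, which has \<open>n + (n - 1)\<close> elements. This leaf therefore has \<open>2n\<close> possible places.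
\<close>

section \<open>Construction sequences\<close>

text \<open>
  Stating the order condition without indices lets the simplifier compute it for
  concatenations of lists.
\<close>

lemma c_sequence_iff_sorted_wrt:
  "c_sequence G xs \<longleftrightarrow> distinct xs \<and> set xs = elements G \<and>
     sorted_wrt (\<lambda>x y. \<not> (\<exists>v e. x = Edge e \<and> y = Vertex v \<and> v \<in> e)) xs"
proof -
  let ?R = "\<lambda>x y. \<not> (\<exists>v e. x = Edge e \<and> y = Vertex v \<and> v \<in> e)"
  have "sorted_wrt ?R xs \<longleftrightarrow> (\<forall>i<length xs. \<forall>j<length xs. \<forall>v e.
          xs ! i = Vertex v \<and> xs ! j = Edge e \<and> v \<in> e \<longrightarrow> i < j)" (is "_ \<longleftrightarrow> ?ordered")
  proof
    assume sorted: "sorted_wrt ?R xs"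
    show ?ordered
    proof (intro allI impI, elim conjE)
      fix i j v e
      assume ij: "i < length xs" "j < length xs" "xs ! i = Vertex v" "xs ! j = Edge e" "v \<in> e"
      then have "\<not> j < i"
        using sorted_wrt_nth_less[OF sorted, of j i] by auto
      moreover have "i \<noteq> j"
        using ij by auto
      ultimately show "i < j"
        by simp
    qed
  next
    assume ordered: ?ordered
    show "sorted_wrt ?R xs"
      unfolding sorted_wrt_iff_nth_less
    proof (intro allI impI notI, elim exE conjE)
      fix i j v e
      assume "i < j" "j < length xs" "xs ! i = Edge e" "xs ! j = Vertex v" "v \<in> e"
      moreover from this have "j < i"
        using ordered by (meson order.strict_trans)
      ultimately show False
        by simp
    qed
  qed
  then show ?thesis
    unfolding c_sequence_def by blast
qed

lemma length_c_sequence: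
  assumes "finite V" "finite E" "c_sequence (V, E) xs"
  shows "length xs = card V + card E"
proof -
  have "length xs = card (Vertex ` V \<union> Edge ` E)"
    using assms(3) distinct_card[of xs] by (simp add: c_sequence_def elements_def)
  also have "\<dots> = card (Vertex ` V) + card (Edge ` E)"
    using assms by (intro card_Un_disjoint) auto
  also have "\<dots> = card V + card E"
    by (simp add: card_image inj_on_def)
  finally show ?thesis .
qed

lemma finite_c_sequences:
  assumes "finite V" "finite E"
  shows "finite {xs. c_sequence (V, E) xs}"
proof (rule finite_subset)
  show "{xs. c_sequence (V, E) xs} \<subseteq>
      {xs. set xs \<subseteq> elements (V, E) \<and> length xs = card V + card E}"
    using length_c_sequence[OF assms] by (auto simp: c_sequence_def)
  show "finite {xs. set xs \<subseteq> elements (V, E) \<and> length xs = card V + card E}"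
    using assms by (intro finite_lists_length_eq) (simp add: elements_def)
qed

section \<open>Adding an isolated vertex\<close>

lemma c_sequence_insert_isolated_iff:
  assumes "v \<notin> V" "v \<notin> \<Union>E"
  shows "c_sequence (insert v V, E) (ys @ Vertex v # zs) \<longleftrightarrow>
         c_sequence (V, E) (ys @ zs) \<and> Vertex v \<notin> set (ys @ zs)"
proof -
  have "Vertex v \<notin> elements (V, E)"
    using assms by (auto simp: elements_def)
  moreover have "elements (insert v V, E) = insert (Vertex v) (elements (V, E))"
    by (simp add: elements_def)
  ultimately have set_iff: "set (ys @ Vertex v # zs) = elements (insert v V, E) \<longleftrightarrow>
      set (ys @ zs) = elements (V, E)" if "Vertex v \<notin> set (ys @ zs)"
    using insert_ident[OF that, of "elements (V, E)"] by simp
  (* no edge contains v, so the order condition holds for every pair formed with Vertex v *)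
  let ?R = "\<lambda>x y. \<not> (\<exists>u e. x = Edge e \<and> y = Vertex u \<and> u \<in> e)"
  have sorted_iff: "sorted_wrt ?R (ys @ Vertex v # zs) \<longleftrightarrow> sorted_wrt ?R (ys @ zs)"
    if "set (ys @ zs) = elements (V, E)"
  proof -
    have "v \<notin> e" if "Edge e \<in> set ys" for e
      using that \<open>set (ys @ zs) = elements (V, E)\<close> assms by (auto simp: elements_def)
    then show ?thesis
      by (auto simp: sorted_wrt_append)
  qed
  have "distinct (ys @ Vertex v # zs) \<longleftrightarrow> distinct (ys @ zs) \<and> Vertex v \<notin> set (ys @ zs)"
    by auto
  then show ?thesis
    unfolding c_sequence_iff_sorted_wrt using set_iff sorted_iff by argo
qed

text \<open>
  The construction sequences of the larger graph correspond to pairs of a construction sequence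
  \<open>xs\<close> of the smaller one and a position in \<open>xs\<close>. The pair can be recovered because the new vertex
  does not occur in \<open>xs\<close>, and there is one position more than there are elements.
\<close>

lemma construction_number_insert_isolated:
  assumes fin: "finite V" "finite E" and v: "v \<notin> V" "v \<notin> \<Union>E"
  shows "construction_number (insert v V, E) =
         (card V + card E + 1) * construction_number (V, E)"
proof -
  define C where "C = {xs. c_sequence (V, E) xs}"
  define f where "f = (\<lambda>(xs, i). take i xs @ Vertex v # drop i xs)"
  let ?D = "C \<times> {..card V + card E}"
  have fresh: "Vertex v \<notin> set xs" if "xs \<in> C" for xs
    using that v by (auto simp: C_def c_sequence_def elements_def)
  have len: "length xs = card V + card E" if "xs \<in> C" for xs
    using that length_c_sequence[OF fin] by (simp add: C_def)
  have "inj_on f ?D"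
  proof (rule inj_onI, clarify)
    fix xs i xs' i'
    assume *: "xs \<in> C" "xs' \<in> C" "i \<le> card V + card E" "i' \<le> card V + card E"
      and "f (xs, i) = f (xs', i')"
    then have eq: "take i xs = take i' xs'" "drop i xs = drop i' xs'"
      using append_Cons_eq_iff[of "Vertex v" "take i xs" "drop i xs" "take i' xs'" "drop i' xs'"]
        fresh[OF *(1)] fresh[OF *(2)]
      by (auto simp: f_def dest: in_set_takeD in_set_dropD)
    then have "xs = xs'"
      by (metis append_take_drop_id)
    moreover have "i = i'"
      using * len eq(1) by (metis length_take min.absorb2)
    ultimately show "xs = xs' \<and> i = i'" ..
  qed
  moreover have "f ` ?D = {xs. c_sequence (insert v V, E) xs}"
  proof (intro subset_antisym subsetI)
    fix ws assume "ws \<in> f ` ?D"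
    then show "ws \<in> {xs. c_sequence (insert v V, E) xs}"
      using fresh by (auto simp: f_def C_def c_sequence_insert_isolated_iff[OF v]
          dest: in_set_takeD in_set_dropD)
  next
    fix ws assume "ws \<in> {xs. c_sequence (insert v V, E) xs}"
    moreover from this have "Vertex v \<in> set ws"
      by (simp add: c_sequence_def elements_def)
    then obtain ys zs where ws: "ws = ys @ Vertex v # zs"
      by (meson split_list)
    ultimately have C: "ys @ zs \<in> C"
      using c_sequence_insert_isolated_iff[OF v] by (simp add: C_def)
    then have "length ys \<le> card V + card E"
      using len by fastforce
    then have "(ys @ zs, length ys) \<in> ?D"
      using C by simp
    moreover have "ws = f (ys @ zs, length ys)"
      by (simp add: f_def ws)
    ultimately show "ws \<in> f ` ?D"
      by blast
  qed
  ultimately have "card {xs. c_sequence (insert v V, E) xs} = card ?D"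
    by (metis card_image)
  then show ?thesis
    by (simp add: construction_number_def C_def card_cartesian_product)
qed

section \<open>Removing the last edge\<close>

lemma c_sequence_snoc_Edge_iff:
  assumes "e \<in> E"
  shows "c_sequence (V, E) (xs @ [Edge e]) \<longleftrightarrow> c_sequence (V, E - {e}) xs"
proof -
  have "Edge e \<notin> set xs \<and> set (xs @ [Edge e]) = elements (V, E) \<longleftrightarrow>
      set xs = elements (V, E - {e})"
    using assms by (auto simp: elements_def)
  then show ?thesis
    by (auto simp: c_sequence_iff_sorted_wrt sorted_wrt_append)
qed

text \<open>
  Construction sequences are classified by their last element. The empty graph has to be
  excluded: its only construction sequence is the empty list, which has no last element.
\<close>

lemma construction_number_remove_edge:
  assumes fin: "finite V" "finite E" and "V \<noteq> {}" and cover: "V \<subseteq> \<Union>E"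
  shows "construction_number (V, E) = (\<Sum>e\<in>E. construction_number (V, E - {e}))"
proof -
  define C where "C = (\<lambda>e. (\<lambda>xs. xs @ [Edge e]) ` {xs. c_sequence (V, E - {e}) xs})"
  have "{xs. c_sequence (V, E) xs} = (\<Union>e\<in>E. C e)"
  proof (intro subset_antisym subsetI)
    fix xs assume "xs \<in> {xs. c_sequence (V, E) xs}"
    then have xs: "c_sequence (V, E) xs" by simp
    then have set: "set xs = elements (V, E)"
      by (simp add: c_sequence_def)
    with \<open>V \<noteq> {}\<close> have "xs \<noteq> []"
      by (auto simp: elements_def)
    then obtain ys x where [simp]: "xs = ys @ [x]"
      by (metis rev_exhaust)
    have "x \<in> elements (V, E)"
      using set by auto
    (* a final vertex would come after the edges that contain it *)
    moreover have "x \<noteq> Vertex v" if v: "v \<in> V" for v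
    proof
      assume "x = Vertex v"
      obtain e where e: "e \<in> E" "v \<in> e"
        using v cover by auto
      then have "Edge e \<in> set ys"
        using set \<open>x = Vertex v\<close> by (auto simp: elements_def)
      then show False
        using xs e \<open>x = Vertex v\<close> by (auto simp: c_sequence_iff_sorted_wrt sorted_wrt_append)
    qed
    ultimately obtain e where "e \<in> E" "x = Edge e"
      by (auto simp: elements_def)
    then show "xs \<in> (\<Union>e\<in>E. C e)"
      using xs c_sequence_snoc_Edge_iff[of e E V ys] by (auto simp: C_def)
  next
    fix xs assume "xs \<in> (\<Union>e\<in>E. C e)"
    then show "xs \<in> {xs. c_sequence (V, E) xs}"
      by (auto simp: C_def c_sequence_snoc_Edge_iff)
  qed
  moreover have "card (\<Union>e\<in>E. C e) = (\<Sum>e\<in>E. card (C e))"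
    using fin by (intro card_UN_disjoint) (auto simp: C_def finite_c_sequences)
  moreover have "card (C e) = construction_number (V, E - {e})" for e
    by (simp add: C_def construction_number_def card_image inj_on_def)
  ultimately show ?thesis
    by (simp add: construction_number_def)
qed

section \<open>Stars\<close>

text \<open>
  With the hub and the leaves as parameters, deleting a leaf together with its edge gives a star
  with the same hub, so the recurrence becomes an induction on the set of leaves.
\<close>

definition star :: "'a \<Rightarrow> 'a set \<Rightarrow> 'a graph" where
  "star h L = (insert h L, (\<lambda>v. {h, v}) ` L)"

lemma inj_on_star_edge: "inj_on (\<lambda>v. {h, v}) L"
  by (auto simp: inj_on_def doubleton_eq_iff)

text \<open>
  The induction step applies both counting facts in turn: an edge \<open>{h, v}\<close> is removed, and then
  its leaf \<open>v\<close>, which has become isolated. A star with a single vertex is the base case because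
  its hub is isolated, so that its construction sequence does not end in an edge.
\<close>

lemma construction_number_star:
  assumes "finite L" "h \<notin> L"
  shows "construction_number (star h L) = 2 ^ card L * (fact (card L))\<^sup>2"
  using assms
proof (induction "card L" arbitrary: L)
  case 0
  then have "L = {}" by simp
  have "c_sequence (star h {}) xs \<longleftrightarrow> xs = [Vertex h]" for xs
  proof
    assume "c_sequence (star h {}) xs"
    then have "distinct xs" "set xs = {Vertex h}"
      by (simp_all add: c_sequence_def star_def elements_def)
    then show "xs = [Vertex h]"
      by (cases xs; cases "tl xs") (auto simp: insert_eq_iff)
  qed (simp add: c_sequence_def star_def elements_def)
  then show ?case
    by (simp add: construction_number_def \<open>L = {}\<close>)
next
  case (Suc n)
  define E where "E = (\<lambda>v. {h, v}) ` L"
  have "finite E"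
    using Suc.prems by (simp add: E_def)
  have "L \<noteq> {}"
    using Suc.hyps(2) by auto
  have remove: "construction_number (insert h L, E - {{h, v}}) =
      2 * Suc n * (2 ^ n * (fact n)\<^sup>2)" if "v \<in> L" for v
  proof -
    let ?L = "L - {v}" and ?E = "(\<lambda>w. {h, w}) ` (L - {v})"
    have card: "card ?L = n"
      using that Suc.hyps(2) by simp
    have "E - {{h, v}} = ?E"
      using inj_on_image_set_diff[OF inj_on_star_edge[of h L], of L "{v}"] that
      by (simp add: E_def)
    moreover have "insert h L = insert v (insert h ?L)"
      using that by auto
    moreover have "construction_number (insert v (insert h ?L), ?E) =
        (card (insert h ?L) + card ?E + 1) * construction_number (insert h ?L, ?E)"
      using that Suc.prems by (intro construction_number_insert_isolated) auto
    moreover have "card (insert h ?L) = Suc n"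
      using Suc.prems card by simp
    moreover have "card ?E = n"
      using card by (simp add: card_image inj_on_star_edge)
    moreover have "construction_number (insert h ?L, ?E) = 2 ^ n * (fact n)\<^sup>2"
      using Suc.hyps(1)[of ?L] Suc.prems card by (simp add: star_def)
    ultimately show ?thesis
      by simp
  qed
  have "construction_number (star h L) = (\<Sum>e\<in>E. construction_number (insert h L, E - {e}))"
    unfolding star_def E_def[symmetric]
    using Suc.prems \<open>finite E\<close> \<open>L \<noteq> {}\<close>
    by (intro construction_number_remove_edge) (auto simp: E_def)
  also have "\<dots> = (\<Sum>e\<in>E. 2 * Suc n * (2 ^ n * (fact n)\<^sup>2))"
    using remove by (intro sum.cong) (auto simp: E_def)
  also have "\<dots> = Suc n * (2 * Suc n * (2 ^ n * (fact n)\<^sup>2))"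
    using Suc.hyps(2) by (simp add: E_def card_image inj_on_star_edge)
  also have "\<dots> = 2 ^ Suc n * (fact (Suc n))\<^sup>2"
    by (simp add: power2_eq_square algebra_simps)
  finally show ?case
    by (simp add: Suc.hyps(2))
qed

theorem theorem1:
  fixes G :: "'a graph" and n :: nat
  assumes "is_star n G"
  shows "construction_number G = 2 ^ n * (fact n)\<^sup>2"
proof -
  obtain h where h: "h \<in> verts G" "card (verts G - {h}) = n"
      "edges G = {{h, v} | v. v \<in> verts G - {h}}" and "finite (verts G)"
    using assms by (auto simp: is_star_def simple_graph_def)
  then have "G = star h (verts G - {h})"
    by (auto simp: star_def prod_eq_iff)
  then show ?thesis
    using construction_number_star[of "verts G - {h}" h] h \<open>finite (verts G)\<close> by simp
qed

end
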